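(* Let $w$ be a finite word over the positive integers. Then $12w\equiv w12$ if and only if the columns of $P(w)$ satisfy both of the following: (a) every column of length $1$ is either a singleton $1$-column or a singleton $2$-column, and if there is any column of length $1$ then both a singleton $1$-column and a singleton $2$-column exist; (b) every column of length at least $2$ contains both an entry $1$ and an entry $2$.
   Context: $P(v)$ is the RSK insertion tableau of $v$ and $\equiv$ is Knuth equivalence ($v\equiv w$ iff $P(v)=P(w)$). A singleton $a$-column of a tableau is a column of length $1$ whose single entry is $a$. *)

theory Defs
  imports Main
begin

text \<open>Tableaux are lists of rows, each row a list of entries from left to right. The first row is
  the one into which letters are inserted.\<close>

type_synonym 'a tableau = "'a list list"

text \<open>Schensted row insertion: the inserted letter replaces the leftmost entry strictly greater
  than it, and that entry is returned as the bumped letter; if no entry is strictly greater, the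
  letter is appended and nothing is bumped.\<close>

fun row_insert :: "'a::linorder \<Rightarrow> 'a list \<Rightarrow> 'a list \<times> 'a option" where
  "row_insert x [] = ([x], None)"
| "row_insert x (y # ys) =
     (if x < y then (x # ys, Some y)
      else (case row_insert x ys of (zs, b) \<Rightarrow> (y # zs, b)))"

fun tableau_insert :: "'a::linorder \<Rightarrow> 'a tableau \<Rightarrow> 'a tableau" where
  "tableau_insert x [] = [[x]]"
| "tableau_insert x (r # rs) =
     (case row_insert x r of
        (r', None) \<Rightarrow> r' # rs
      | (r', Some y) \<Rightarrow> r' # tableau_insert y rs)"

definition insertion_tableau :: "'a::linorder list \<Rightarrow> 'a tableau" where
  "insertion_tableau w = fold tableau_insert w []"

definition knuth_equiv :: "'a::linorder list \<Rightarrow> 'a list \<Rightarrow> bool" where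
  "knuth_equiv v w \<longleftrightarrow> insertion_tableau v = insertion_tableau w"

text \<open>The columns of a tableau from left to right, each read from the first row onwards. When row
  lengths are weakly decreasing, as in insertion tableaux, the list transpose
  yields exactly these.\<close>

definition columns :: "'a tableau \<Rightarrow> 'a list list" where
  "columns T = transpose T"

definition singleton_column :: "'a \<Rightarrow> 'a list \<Rightarrow> bool" where
  "singleton_column a c \<longleftrightarrow> c = [a]"

end

theory Submission
  imports Defs "HOL-Library.Multiset"
begin

text \<open>Prepending 1 to a word over the positive integers only prepends 1 to the first row of its
  tableau, since a leading 1 is never bumped. Prepending 2 only affects the first two rows: the new
  2 pushes an initial part of the second row one step to the right, and the last letter e pushed
  either stays in the second row or drops into the first. This relation between the two pairs of
  rows is preserved by every further insertion, and both pairs send the same letters to the third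
  row. On the other hand, inserting 1 and then 2 into the tableau of w can only give the same first
  row if no letter other than a 2 is bumped from it, and comparing the first two rows then leaves
  precisely the shapes in the theorem.\<close>

section \<open>Row insertion into a single row\<close>

lemma row_insert_append_le:
  "\<forall>u\<in>set us. u \<le> x \<Longrightarrow> row_insert x (us @ vs) = apfst ((@) us) (row_insert x vs)"
proof (induction us)
  case Nil
  then show ?case by (cases "row_insert x vs") simp
next
  case (Cons u us)
  then show ?case by (cases "row_insert x vs") (simp add: leD)
qed

lemma row_insert_le:
  "\<forall>u\<in>set us. u \<le> x \<Longrightarrow> row_insert x us = (us @ [x], None)"
  using row_insert_append_le[of us x "[]"] by simp

lemma row_insert_append_bump:
  "row_insert x us = (us', Some b) \<Longrightarrow> row_insert x (us @ vs) = (us' @ vs, Some b)"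
  by (induction us arbitrary: us') (auto split: prod.splits if_splits)

lemma row_insert_NoneD:
  "row_insert x us = (us', None) \<Longrightarrow> us' = us @ [x] \<and> (\<forall>u\<in>set us. u \<le> x)"
  by (induction us arbitrary: us') (auto split: prod.splits if_splits)

lemma row_insert_SomeD:
  "row_insert x us = (us', Some b) \<Longrightarrow>
    x < b \<and> b \<in> set us \<and> length us' = length us \<and> add_mset b (mset us') = add_mset x (mset us)"
  by (induction us arbitrary: us') (auto split: prod.splits if_splits)

lemma row_insert_set:
  "row_insert x us = (us', c) \<Longrightarrow> set us' \<subseteq> insert x (set us)"
  by (induction us arbitrary: us' c) (auto split: prod.splits if_splits)

lemma row_insert_sorted: "sorted us \<Longrightarrow> sorted (fst (row_insert x us))"
proof (induction us)
  case (Cons u us)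
  obtain us' c where r: "row_insert x us = (us', c)" by force
  then show ?case using Cons row_insert_set[OF r] by auto
qed simp

section \<open>Two adjacent rows: strict columns and bumping\<close>

text \<open>The first argument is the upper row. One recursion carries both the shape condition and
  the strict increase down the columns, so that inductions treat the two together.\<close>

fun column_strict :: "'a::linorder list \<Rightarrow> 'a list \<Rightarrow> bool" where
  "column_strict _ [] \<longleftrightarrow> True"
| "column_strict [] (y # ys) \<longleftrightarrow> False"
| "column_strict (x # xs) (y # ys) \<longleftrightarrow> x < y \<and> column_strict xs ys"

lemma column_strict_length: "column_strict xs ys \<Longrightarrow> length ys \<le> length xs"
  by (induction xs ys rule: column_strict.induct) auto

lemma column_strict_nth: "column_strict xs ys \<Longrightarrow> i < length ys \<Longrightarrow> xs ! i < ys ! i"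
  by (induction xs ys arbitrary: i rule: column_strict.induct) (auto simp: nth_Cons')

lemma column_strict_append:
  "length xs = length ys \<Longrightarrow> column_strict xs ys \<Longrightarrow>
    column_strict (xs @ xs') (ys @ ys') = column_strict xs' ys'"
  by (induction xs ys rule: list_induct2) auto

lemma column_strict_extend: "column_strict xs ys \<Longrightarrow> column_strict (xs @ zs) ys"
  by (induction xs ys rule: column_strict.induct) auto

lemma column_strict_bump_top:
  "column_strict xs ys \<Longrightarrow> row_insert x xs = (xs', Some b) \<Longrightarrow> column_strict xs' ys"
  by (induction xs ys arbitrary: xs' rule: column_strict.induct)
    (auto split: prod.splits if_splits)

text \<open>The bumped letter never moves to the right: the entry below its old place, if there is
  one, exceeds \<open>b\<close>. So \<open>b\<close> lands weakly left of that place, under an entry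
  of \<open>xs'\<close> smaller than \<open>b\<close>. The entries of \<open>xs'\<close> elsewhere
  can only have decreased, by \<open>column_strict_bump_top\<close>.\<close>

lemma column_strict_bump:
  "column_strict xs ys \<Longrightarrow> row_insert x xs = (xs', Some b) \<Longrightarrow>
    column_strict xs' (fst (row_insert b ys))"
proof (induction xs ys arbitrary: xs' rule: column_strict.induct)
  case (1 xs)
  then show ?case by (cases xs) (auto dest!: row_insert_SomeD split: prod.splits if_splits)
next
  case (3 u us v vs)
  show ?case
  proof (cases "x < u")
    case True
    then show ?thesis using 3 by auto
  next
    case False
    then obtain us' where us': "row_insert x us = (us', Some b)" "xs' = u # us'"
      using 3 by (auto split: prod.splits)
    then have "u < b" "column_strict us' vs" "column_strict us' (fst (row_insert b vs))"
      using 3 False row_insert_SomeD[OF us'(1)] column_strict_bump_top[OF _ us'(1)] by auto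
    then show ?thesis using us' 3 by (auto split: prod.splits)
  qed
qed simp

lemma column_strict_lower_bound:
  fixes xs :: "nat list"
  shows "column_strict xs ys \<Longrightarrow> \<forall>x\<in>set xs. k \<le> x \<Longrightarrow> \<forall>y\<in>set ys. Suc k \<le> y"
  by (induction xs ys rule: column_strict.induct) auto

text \<open>Missing rows are treated as empty rows; insertion into either has the same effect.\<close>

definition top_row :: "'a tableau \<Rightarrow> 'a list" where
  "top_row T = (case T of [] \<Rightarrow> [] | r # _ \<Rightarrow> r)"

lemma top_row_simps [simp]: "top_row [] = []" "top_row (r # rs) = r"
  by (simp_all add: top_row_def)

lemma top_row_tableau_insert: "top_row (tableau_insert x T) = fst (row_insert x (top_row T))"
  by (cases T) (auto split: prod.splits option.splits)

lemma tl_tableau_insert: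
  "tl (tableau_insert x T) =
    (case snd (row_insert x (top_row T)) of None \<Rightarrow> tl T | Some b \<Rightarrow> tableau_insert b (tl T))"
  by (cases T) (auto split: prod.splits option.splits)

section \<open>Semistandard tableaux\<close>

text \<open>Rows are required to be nonempty because \<open>top_row\<close> and \<open>tl\<close>
  cannot tell \<open>[]\<close> from \<open>[[]]\<close>; with this clause they determine the
  tableau.\<close>

fun semistandard :: "'a::linorder tableau \<Rightarrow> bool" where
  "semistandard [] \<longleftrightarrow> True"
| "semistandard (r # rs) \<longleftrightarrow>
    r \<noteq> [] \<and> sorted r \<and> column_strict r (top_row rs) \<and> semistandard rs"

lemma row_insert_nonempty: "fst (row_insert x r) \<noteq> []"
  by (cases r) (auto split: prod.splits)

lemma semistandard_tableau_insert: "semistandard T \<Longrightarrow> semistandard (tableau_insert x T)"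
proof (induction T arbitrary: x)
  case (Cons r rs)
  obtain r' c where r: "row_insert x r = (r', c)" by force
  have "r' \<noteq> []" "sorted r'"
    using row_insert_nonempty[of x r] row_insert_sorted[of r x] Cons.prems r by auto
  then show ?case
    using Cons r
    by (cases c) (auto simp: top_row_tableau_insert
        dest: row_insert_NoneD intro: column_strict_extend column_strict_bump)
qed simp

lemma semistandard_fold: "semistandard T \<Longrightarrow> semistandard (fold tableau_insert w T)"
  by (induction w arbitrary: T) (auto simp: semistandard_tableau_insert)

lemma semistandard_insertion_tableau: "semistandard (insertion_tableau w)"
  by (simp add: insertion_tableau_def semistandard_fold)

text \<open>Only the first two rows are ever compared explicitly; everything below is carried along
  as one block.\<close>

lemma semistandard_eqI:
  assumes "semistandard T" "semistandard T'"
    and "top_row T = top_row T'" "top_row (tl T) = top_row (tl T')" "tl (tl T) = tl (tl T')"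
  shows "T = T'"
proof -
  have e: "U = U'" if "semistandard U" "semistandard U'" "top_row U = top_row U'" "tl U = tl U'"
    for U U' :: "'a tableau"
    using that by (cases U; cases U') auto
  have "semistandard (tl T)" "semistandard (tl T')"
    using assms(1,2) by (cases T; cases T'; simp)+
  then show ?thesis using assms e by blast
qed

section \<open>Prepending the letters 1 and 2 to a word\<close>

lemma row_insert_minimum: "m \<le> x \<Longrightarrow> row_insert x (m # r) = apfst ((#) m) (row_insert x r)"
  by (auto split: prod.splits)

text \<open>Bumping needs a strictly smaller letter, so a leading \<open>m\<close> stays in place.
  Both tableaux then bump the same letters out of the first row, and the rows below develop
  identically.\<close>

lemma fold_tableau_insert_minimum:
  assumes "\<forall>x\<in>set w. m \<le> x" "top_row T' = m # top_row T" "tl T' = tl T"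
  shows "top_row (fold tableau_insert w T') = m # top_row (fold tableau_insert w T) \<and>
    tl (fold tableau_insert w T') = tl (fold tableau_insert w T)"
  using assms
proof (induction w arbitrary: T T')
  case (Cons x w)
  then have "top_row (tableau_insert x T') = m # top_row (tableau_insert x T)"
    "tl (tableau_insert x T') = tl (tableau_insert x T)"
    by (simp_all add: top_row_tableau_insert tl_tableau_insert row_insert_minimum
        del: row_insert.simps split: option.split)
  then show ?case using Cons by simp
qed simp

text \<open>Here s, t are the first two rows for w, and s', t' those for 2w. In the second case e is the
  letter pushed from the second row into the first one; the equation for L2 and q also covers words
  without the letter 1, where L1, L2 and q are empty and e = 2.\<close>

definition left_insert2 :: "nat list \<Rightarrow> nat list \<Rightarrow> nat list \<Rightarrow> nat list \<Rightarrow> bool" where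
  "left_insert2 s t s' t' \<longleftrightarrow>
    s' = s \<and> t' = 2 # t \<and> column_strict s (2 # t) \<or>
    (\<exists>L1 L2 e R1 R2 q. s = L1 @ R1 \<and> s' = L1 @ e # R1 \<and> L2 @ [e] = 2 # q \<and>
      t = q @ R2 \<and> t' = L2 @ R2 \<and> length L1 = length L2 \<and> column_strict L1 L2 \<and>
      column_strict R1 R2 \<and> sorted R1 \<and> (\<forall>x\<in>set L1. x < e) \<and> (\<forall>x\<in>set L2. x \<le> e) \<and>
      (\<forall>x\<in>set R1. e \<le> x))"

lemma left_insert2I:
  assumes "L2 @ [e] = 2 # q" "length L1 = length L2" "column_strict L1 L2" "column_strict R1 R2"
    "sorted R1" "\<forall>x\<in>set L1. x < e" "\<forall>x\<in>set L2. x \<le> e" "\<forall>x\<in>set R1. e \<le> x"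
  shows "left_insert2 (L1 @ R1) (q @ R2) (L1 @ e # R1) (L2 @ R2)"
  using assms unfolding left_insert2_def by blast

text \<open>The response of the second row to the first row's output. It allows the two rows to be
  viewed as one device that receives a letter and possibly emits one to the third row.\<close>

definition lower_insert :: "'a::linorder option \<Rightarrow> 'a list \<Rightarrow> 'a list \<times> 'a option" where
  "lower_insert b t = (case b of None \<Rightarrow> (t, None) | Some x \<Rightarrow> row_insert x t)"

text \<open>The first alternative reproduces itself. In the second, the place of \<open>y\<close>
  relative to \<open>e\<close> decides: to the right of \<open>e\<close> or inside \<open>L1\<close>
  the shape persists with the same \<open>e\<close>, while a letter that displaces \<open>e\<close>
  from \<open>s'\<close> moves the dividing column one step to the right or ends the second
  alternative. The emitted letters agree in every case.\<close>

lemma left_insert2_step: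
  assumes inv: "left_insert2 s t s' t'" and y: "1 \<le> y"
    and s1: "row_insert y s = (s1, b)" and t1: "lower_insert b t = (t1, c)"
    and s1': "row_insert y s' = (s1', b')" and t1': "lower_insert b' t' = (t1', c')"
  shows "left_insert2 s1 t1 s1' t1' \<and> c' = c"
  using inv[unfolded left_insert2_def]
proof (elim disjE conjE exE)
  assume eq: "s' = s" "t' = 2 # t" and cs: "column_strict s (2 # t)"
  have s1eq: "s1' = s1" "b' = b" using eq s1 s1' by auto
  show ?thesis
  proof (cases b)
    case None
    then show ?thesis
      using s1eq eq t1 t1' row_insert_NoneD[of y s s1] column_strict_extend[OF cs] s1
      by (auto simp: left_insert2_def lower_insert_def)
  next
    case (Some x)
    \<comment> \<open>The bumped letter exceeds \<open>y\<close>, hence 1, so it passes the leading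
      2 of \<open>t'\<close>.\<close>
    then have "2 \<le> x" using row_insert_SomeD[of y s s1 x] s1 y by auto
    then have r: "row_insert x (2 # t) = (2 # t1, c)"
      using t1 Some by (simp add: lower_insert_def)
    have "column_strict s1 (2 # t1)"
      using column_strict_bump[OF cs] s1 Some r by force
    then show ?thesis
      using r t1' Some eq s1eq by (auto simp: left_insert2_def lower_insert_def)
  qed
next
  fix L1 L2 e R1 R2 q
  assume s: "s = L1 @ R1" and s': "s' = L1 @ e # R1" and q: "L2 @ [e] = 2 # q"
    and t: "t = q @ R2" and t': "t' = L2 @ R2" and len: "length L1 = length L2"
    and csL: "column_strict L1 L2" and csR: "column_strict R1 R2" and R1s: "sorted R1"
    and L1e: "\<forall>x\<in>set L1. x < e" and L2e: "\<forall>x\<in>set L2. x \<le> e" and R1e: "\<forall>x\<in>set R1. e \<le> x"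
  have qe: "\<forall>x\<in>set q. x \<le> e"
    using L2e q by (cases L2) auto
  have e2: "2 \<le> e" using L2e q by (cases L2) auto
  consider (right) "e \<le> y" | (mid) L where "y < e" "row_insert y L1 = (L, None)"
    | (left) L x where "y < e" "row_insert y L1 = (L, Some x)"
    by (metis not_le surj_pair option.exhaust)
  then show ?thesis
  proof cases
    case right
    obtain R b0 where R: "row_insert y R1 = (R, b0)" by force
    have L1y: "\<forall>x\<in>set L1. x \<le> y" "\<forall>x\<in>set (L1 @ [e]). x \<le> y" using L1e right by auto
    have b: "s1 = L1 @ R" "b = b0" "s1' = L1 @ e # R" "b' = b0"
      using row_insert_append_le[OF L1y(1), of R1] row_insert_append_le[OF L1y(2), of R1] s s' s1 s1' R
      by auto
    have sR: "sorted R" using row_insert_sorted[OF R1s, of y] R by simp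
    have eR: "\<forall>x\<in>set R. e \<le> x" using row_insert_set[OF R] R1e right by auto
    show ?thesis
    proof (cases b0)
      case None
      then have "column_strict R R2" using row_insert_NoneD[of y R1 R] R csR column_strict_extend by auto
      then show ?thesis using None b t t' t1 t1' left_insert2I[OF q len csL _ sR L1e L2e eR]
        by (auto simp: lower_insert_def)
    next
      case (Some x)
      \<comment> \<open>A letter above \<open>e\<close> exceeds all of \<open>q\<close> and
        \<open>L2\<close>, so both second rows insert it into \<open>R2\<close>.\<close>
      then have ex: "e < x" using row_insert_SomeD[of y R1 R x] R right by auto
      obtain R2' c0 where R2': "row_insert x R2 = (R2', c0)" by force
      have "\<forall>u\<in>set q. u \<le> x" "\<forall>u\<in>set L2. u \<le> x" using ex qe L2e by auto
      then have "t1 = q @ R2'" "c = c0" "t1' = L2 @ R2'" "c' = c0"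
        using row_insert_append_le[of q x R2] row_insert_append_le[of L2 x R2] R2' t t' t1 t1' b Some
        by (auto simp: lower_insert_def)
      moreover have "column_strict R R2'"
        using column_strict_bump[OF csR] R Some R2' by force
      ultimately show ?thesis using b left_insert2I[OF q len csL _ sR L1e L2e eR] by simp
    qed
  next
    case mid
    have L1y: "\<forall>x\<in>set L1. x \<le> y" using row_insert_NoneD[OF mid(2)] by auto
    have a: "s1' = L1 @ y # R1" "b' = Some e"
      using row_insert_append_le[OF L1y, of "e # R1"] s' s1' mid by auto
    have i': "row_insert e (L2 @ R2) = apfst ((@) L2) (row_insert e R2)"
      using L2e by (intro row_insert_append_le) auto
    show ?thesis
    proof (cases R1)
      \<comment> \<open>The dividing column has reached the end of the first row: both first rows
        become \<open>L1 @ [y]\<close>, and \<open>e\<close> drops below to complete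
        \<open>L2 @ [e] = 2 # q\<close>. This is the first alternative.\<close>
      case Nil
      then have R2: "R2 = []" using column_strict_length[OF csR] by simp
      have "s1 = L1 @ [y]" "b = None"
        using row_insert_append_le[OF L1y, of "[]"] s s1 Nil by auto
      moreover have "column_strict (L1 @ [y]) (2 # q)"
        unfolding q[symmetric] using column_strict_append[OF len csL, of "[y]" "[e]"] mid by simp
      ultimately show ?thesis
        using a i' q t t' t1 t1' Nil R2 unfolding left_insert2_def lower_insert_def by auto
    next
      \<comment> \<open>Here \<open>y\<close> displaces \<open>r\<close> from \<open>s\<close> but
        \<open>e\<close> from \<open>s'\<close>. In the new data \<open>L1 @ [y]\<close> and
        \<open>L2 @ [e]\<close> replace \<open>L1\<close> and \<open>L2\<close>, and
        \<open>r\<close> takes over the role of \<open>e\<close>.\<close>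
      case (Cons r R1')
      have er: "e \<le> r" "y < r" using R1e Cons mid by auto
      have b: "s1 = L1 @ y # R1'" "b = Some r"
        using row_insert_append_le[OF L1y, of R1] s s1 Cons er by auto
      have i: "row_insert r (q @ R2) = apfst ((@) q) (row_insert r R2)"
        using qe er by (intro row_insert_append_le) auto
      \<comment> \<open>The first entry of \<open>R2\<close> lies below \<open>r\<close>, so it
        exceeds both \<open>r\<close> and \<open>e\<close>: each of them displaces it, or is
        appended if \<open>R2\<close> is empty.\<close>
      obtain c0 where c0: "row_insert r R2 = (r # tl R2, c0)" "row_insert e R2 = (e # tl R2, c0)"
        using csR Cons er by (cases R2) auto
      have "t1 = q @ r # tl R2" "c = c0" "t1' = L2 @ e # tl R2" "c' = c0"
        using i i' c0 a b t t' t1 t1' by (auto simp: lower_insert_def)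
      moreover have "column_strict (L1 @ [y]) (L2 @ [e])"
        using column_strict_append[OF len csL, of "[y]" "[e]"] mid by simp
      moreover have "column_strict R1' (tl R2)" using csR Cons by (cases R2) auto
      moreover have "\<forall>x\<in>set R1'. r \<le> x" "sorted R1'" using R1s Cons by auto
      moreover have "\<forall>x\<in>set (L1 @ [y]). x < r" "\<forall>x\<in>set (L2 @ [e]). x \<le> r"
        using L1e L2e er by auto
      moreover have "(L2 @ [e]) @ [r] = 2 # (q @ [r])" using q by simp
      moreover have "length (L1 @ [y]) = length (L2 @ [e])" using len by simp
      ultimately have "left_insert2 ((L1 @ [y]) @ R1') ((q @ [r]) @ tl R2)
          ((L1 @ [y]) @ r # R1') ((L2 @ [e]) @ tl R2)"
        by (intro left_insert2I)
      then show ?thesis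
        using a b Cons t1 \<open>t1 = _\<close> \<open>t1' = _\<close> \<open>c = _\<close> \<open>c' = _\<close> by simp
    qed
  next
    case left
    have x: "y < x" "x < e" "length L = length L1"
      using row_insert_SomeD[OF left(2)] L1e by auto
    have b: "s1 = L @ R1" "b = Some x" "s1' = L @ e # R1" "b' = Some x"
      using row_insert_append_bump[OF left(2)] s s' s1 s1' by auto
    obtain L2' c0 where L2': "row_insert x L2 = (L2', c0)" by force
    have cs: "column_strict L L2'" using column_strict_bump[OF csL left(2)] L2' by simp
    \<comment> \<open>Without a bump \<open>L2'\<close> would be longer than \<open>L\<close>,
      contrary to column strictness.\<close>
    obtain z where z: "c0 = Some z"
      using column_strict_length[OF cs] row_insert_NoneD[of x L2 L2'] L2' x len by (cases c0) auto
    \<comment> \<open>The lists \<open>L2\<close> and \<open>q\<close> share \<open>u\<close>. Since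
      \<open>x\<close> is at least 2 it passes the leading 2, so in both second rows the bump of
      \<open>z\<close> happens inside \<open>u\<close>.\<close>
    obtain u where u: "L2 = 2 # u" "q = u @ [e]"
      using q len row_insert_SomeD[OF left(2)] by (cases L2) auto
    obtain u' where u': "L2' = 2 # u'" "row_insert x u = (u', Some z)"
      using L2' z x y u by (auto split: prod.splits)
    have "t1 = u' @ e # R2" "c = Some z" "t1' = L2' @ R2" "c' = Some z"
      using row_insert_append_bump[OF u'(2), of "e # R2"] row_insert_append_bump[of x L2 L2' z R2]
        L2' z b t t' t1 t1' u by (auto simp: lower_insert_def)
    moreover have "\<forall>x\<in>set L. x < e" "\<forall>x\<in>set L2'. x \<le> e"
      using row_insert_set[OF left(2)] row_insert_set[OF L2'] L1e L2e x by fastforce+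
    moreover have "length L = length L2'"
      using row_insert_SomeD[of x L2 L2' z] L2' z x len by simp
    ultimately show ?thesis
      using left_insert2I[of L2' e "u' @ [e]" L R1 R2] b cs csR R1s R1e u'(1) by simp
  qed
qed

lemma top_row_tl_tableau_insert:
  "top_row (tl (tableau_insert x T)) =
    fst (lower_insert (snd (row_insert x (top_row T))) (top_row (tl T)))"
  by (simp add: tl_tableau_insert top_row_tableau_insert lower_insert_def split: option.splits)

lemma tl_tl_tableau_insert:
  "tl (tl (tableau_insert x T)) =
    (case snd (lower_insert (snd (row_insert x (top_row T))) (top_row (tl T))) of
      None \<Rightarrow> tl (tl T) | Some c \<Rightarrow> tableau_insert c (tl (tl T)))"
  by (simp add: tl_tableau_insert lower_insert_def split: option.splits)

lemma left_insert2_fold: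
  assumes "\<forall>a\<in>set w. 1 \<le> a"
    and "left_insert2 (top_row T) (top_row (tl T)) (top_row T') (top_row (tl T'))"
    and "tl (tl T') = tl (tl T)"
  shows "left_insert2 (top_row (fold tableau_insert w T)) (top_row (tl (fold tableau_insert w T)))
      (top_row (fold tableau_insert w T')) (top_row (tl (fold tableau_insert w T'))) \<and>
    tl (tl (fold tableau_insert w T')) = tl (tl (fold tableau_insert w T))"
  using assms
proof (induction w arbitrary: T T')
  case (Cons y w)
  obtain s1 b where s1: "row_insert y (top_row T) = (s1, b)" by force
  obtain t1 c where t1: "lower_insert b (top_row (tl T)) = (t1, c)" by force
  obtain s1' b' where s1': "row_insert y (top_row T') = (s1', b')" by force
  obtain t1' c' where t1': "lower_insert b' (top_row (tl T')) = (t1', c')" by force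
  have "left_insert2 s1 t1 s1' t1' \<and> c' = c"
    using left_insert2_step[OF Cons.prems(2) _ s1 t1 s1' t1'] Cons.prems(1) by simp
  then have "left_insert2 (top_row (tableau_insert y T)) (top_row (tl (tableau_insert y T)))
      (top_row (tableau_insert y T')) (top_row (tl (tableau_insert y T')))"
    "tl (tl (tableau_insert y T')) = tl (tl (tableau_insert y T))"
    using s1 t1 s1' t1' Cons.prems(3)
    by (simp_all split: option.split add: top_row_tableau_insert top_row_tl_tableau_insert tl_tl_tableau_insert)
  then show ?case
    using Cons by simp
qed simp

lemma insertion_tableau_12_append:
  fixes w :: "nat list"
  assumes w: "\<forall>a\<in>set w. 1 \<le> a"
  obtains s' t' where
    "left_insert2 (top_row (insertion_tableau w)) (top_row (tl (insertion_tableau w))) s' t'"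
    "top_row (insertion_tableau ([1, 2] @ w)) = 1 # s'"
    "top_row (tl (insertion_tableau ([1, 2] @ w))) = t'"
    "tl (tl (insertion_tableau ([1, 2] @ w))) = tl (tl (insertion_tableau w))"
proof -
  let ?U = "fold tableau_insert w [[2]]"
  \<comment> \<open>For the empty word the letter 2 stands alone in the first row: it is
    \<open>e\<close>, and all lists of the second alternative are empty.\<close>
  have "left_insert2 [] [] [2] []"
    unfolding left_insert2_def
    by (intro disjI2 exI[of _ "[]"] exI[of _ 2]) simp
  then have "left_insert2 (top_row (insertion_tableau w)) (top_row (tl (insertion_tableau w)))
      (top_row ?U) (top_row (tl ?U)) \<and> tl (tl ?U) = tl (tl (insertion_tableau w))"
    unfolding insertion_tableau_def by (intro left_insert2_fold[OF w]) simp_all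
  moreover have "insertion_tableau ([1, 2] @ w) = fold tableau_insert w [[1, 2]]"
    by (simp add: insertion_tableau_def)
  moreover have "top_row (fold tableau_insert w [[1, 2]]) = 1 # top_row ?U \<and>
      tl (fold tableau_insert w [[1, 2]]) = tl ?U"
    by (intro fold_tableau_insert_minimum[OF w]) simp_all
  ultimately show thesis using that by metis
qed

section \<open>Appending 1 and 2, and comparing the first two rows\<close>

text \<open>The column conditions of the theorem, read off the first two rows \<open>s\<close> and
  \<open>t\<close>. The indices from \<open>length t\<close> on are the columns of length 1.\<close>

definition balanced12 :: "nat list \<Rightarrow> nat list \<Rightarrow> bool" where
  "balanced12 s t \<longleftrightarrow>
    (\<forall>i<length t. s ! i = 1 \<and> t ! i = 2) \<and>
    (\<forall>i<length s. length t \<le> i \<longrightarrow> s ! i = 1 \<or> s ! i = 2) \<and>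
    (length t < length s \<longrightarrow>
      (\<exists>i<length s. length t \<le> i \<and> s ! i = 1) \<and> (\<exists>i<length s. length t \<le> i \<and> s ! i = 2))"

text \<open>A word commuting with a letter is a power of it; this is how constant rows are
  recognised.\<close>

lemma replicate_eq_if_snoc_eq_Cons: "xs @ [a] = a # xs \<Longrightarrow> xs = replicate (length xs) a"
  by (induction xs) auto

lemma sorted_mset_eqI: "sorted xs \<Longrightarrow> sorted ys \<Longrightarrow> mset xs = mset ys \<Longrightarrow> xs = ys"
  by (metis properties_for_sort)

text \<open>Both directions track the letters bumped by the final 1 and 2. If the 1 bumps nothing,
  \<open>s\<close> consists of ones and there are no columns of length 1. Otherwise the row lengths
  force the 2 to be appended and select the first alternative of \<open>left_insert2\<close>, where
  the 1 bumps a 2.\<close>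

lemma balanced12_iff:
  fixes T :: "nat tableau"
  assumes T: "semistandard T" and s1: "\<forall>a\<in>set (top_row T). 1 \<le> a"
    and inv: "left_insert2 (top_row T) (top_row (tl T)) s' t'"
    and U: "U = tableau_insert 2 (tableau_insert 1 T)"
  shows "top_row U = 1 # s' \<and> top_row (tl U) = t' \<and> tl (tl U) = tl (tl T) \<longleftrightarrow>
    balanced12 (top_row T) (top_row (tl T))"
proof -
  define s t where st: "s = top_row T" "t = top_row (tl T)"
  have cs: "column_strict s t" and sorted_s: "sorted s"
    using T unfolding st by (cases T; simp)+
  have inv: "left_insert2 s t s' t'" and s1: "\<forall>a\<in>set s. 1 \<le> a"
    using inv s1 unfolding st by simp_all
  obtain sa b where sa: "row_insert 1 s = (sa, b)" by force
  obtain sb b2 where sb: "row_insert 2 sa = (sb, b2)" by force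
  obtain ta c where ta: "lower_insert b t = (ta, c)" by force
  obtain tb c2 where tb: "lower_insert b2 ta = (tb, c2)" by force
  have top: "top_row U = sb"
    unfolding U by (simp add: top_row_tableau_insert st[symmetric] sa sb del: One_nat_def)
  have snd_row: "top_row (tl U) = tb"
    unfolding U by (simp add: top_row_tl_tableau_insert top_row_tableau_insert
        st[symmetric] sa sb ta tb del: One_nat_def)
  have rest: "tl (tl U) = tl (tl T)" if "c = None" "c2 = None"
    unfolding U using that
    by (simp add: tl_tl_tableau_insert top_row_tl_tableau_insert top_row_tableau_insert
        st[symmetric] sa sb ta tb del: One_nat_def)
  consider (eq) "s' = s" "t' = 2 # t" "column_strict s (2 # t)"
    | (ext) L1 L2 e R1 R2 q where "s = L1 @ R1" "s' = L1 @ e # R1" "L2 @ [e] = 2 # q"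
      "t = q @ R2" "t' = L2 @ R2" "length L1 = length L2" "column_strict L1 L2"
      "column_strict R1 R2" "\<forall>x\<in>set L1. x < e" "\<forall>x\<in>set L2. x \<le> e" "\<forall>x\<in>set R1. e \<le> x" "2 \<le> e"
  proof -
    have "2 \<le> e" if "L2 @ [e] = 2 # q" "\<forall>x\<in>set L2. x \<le> e" for L2 q :: "nat list" and e
      using that by (cases L2) auto
    note e2 = this
    from inv show thesis
      unfolding left_insert2_def
    proof (elim disjE exE conjE)
      assume "s' = s" "t' = 2 # t" "column_strict s (2 # t)"
      then show thesis by (rule eq)
    next
      fix L1 L2 e R1 R2 q
      assume *: "s = L1 @ R1" "s' = L1 @ e # R1" "L2 @ [e] = 2 # q"
        "t = q @ R2" "t' = L2 @ R2" "length L1 = length L2" "column_strict L1 L2"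
        "column_strict R1 R2" "\<forall>x\<in>set L1. x < e" "\<forall>x\<in>set L2. x \<le> e" "\<forall>x\<in>set R1. e \<le> x"
      from * e2[OF *(3,10)] show thesis by (rule ext)
    qed
  qed
  note inv_cases = this
  have "balanced12 s t" if *: "sb = 1 # s'" "tb = t'"
  proof (cases b)
    case None
    then have n: "sa = s @ [1]" "\<forall>u\<in>set s. u \<le> 1" using row_insert_NoneD[of 1 s sa] sa by auto
    then have "\<forall>u\<in>set sa. u \<le> 2" by auto
    from row_insert_le[OF this] have sb': "sb = s @ [1, 2]" "b2 = None" using sb n by auto
    then have tt: "t' = t" using ta tb None * by (simp add: lower_insert_def)
    from inv_cases show ?thesis
    proof cases
      case eq
      then show ?thesis using tt by simp
    next
      case ext
      \<comment> \<open>Entries of \<open>R1\<close> are at least \<open>e\<close>, hence at least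
        2, but those of \<open>s\<close> are at most 1.\<close>
      have "R1 = []" using ext n by (cases R1) auto
      then have R: "R1 = []" "R2 = []" using ext column_strict_length[of R1 R2] by auto
      then have q: "q = L2" using tt ext by simp
      then have e: "L2 @ [e] = 2 # L2" using ext by simp
      from arg_cong[OF this, of mset] have "e = 2" by simp
      then have "L2 = replicate (length L2) 2" using e replicate_eq_if_snoc_eq_Cons[of L2 2] by simp
      then have "\<forall>i<length t. t ! i = 2" using q R ext by (metis append_Nil2 nth_replicate)
      moreover have "\<forall>i<length s. s ! i = 1" using n s1 by (auto simp: le_antisym)
      moreover have "length s = length t" using R q ext by simp
      ultimately show ?thesis by (auto simp: balanced12_def)
    qed
  next
    case (Some x)
    have x: "add_mset x (mset sa) = add_mset 1 (mset s)" "x \<in> set s" "1 < x"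
      using row_insert_SomeD[of 1 s sa x] sa Some by auto
    have sub: "mset s \<subseteq># mset s'" using inv_cases by cases auto
    \<comment> \<open>Two bumps would leave the first row as long as \<open>s\<close>, while
      \<open>1 # s'\<close> is longer than \<open>s\<close>.\<close>
    have b2: "b2 = None"
    proof (rule ccontr)
      assume "b2 \<noteq> None"
      then have "length sb = length sa" using row_insert_SomeD[of 2 sa sb] sb by auto
      moreover have "length sa = length s" using row_insert_SomeD[of 1 s sa x] sa Some by simp
      ultimately have "Suc (length s') = length s" using * by simp
      then show False using size_mset_mono[OF sub] by simp
    qed
    then have n: "sb = sa @ [2]" "\<forall>u\<in>set sa. u \<le> 2" using row_insert_NoneD[of 2 sa sb] sb by auto
    have "1 # s' = sa @ [2]" using * n by simp
    from arg_cong[OF this, of mset] have h: "add_mset 1 (mset s') = add_mset 2 (mset sa)" by simp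
    have "add_mset 1 (add_mset x (mset s')) = add_mset x (add_mset 2 (mset sa))"
      unfolding h[symmetric] by (rule add_mset_commute)
    also have "\<dots> = add_mset 1 (add_mset 2 (mset s))"
      using x(1) by (simp add: add_mset_commute)
    finally have m: "add_mset x (mset s') = add_mset 2 (mset s)" by simp
    \<comment> \<open>Equal lengths exclude the second alternative, in which \<open>s'\<close> has
      the extra entry \<open>e\<close>.\<close>
    from arg_cong[OF this, of size] have len: "length s' = length s" by simp
    from inv_cases have e: "s' = s \<and> t' = 2 # t \<and> column_strict s (2 # t)"
    proof cases
      case ext
      then show ?thesis using len by simp
    qed simp
    then have e: "s' = s" "t' = 2 # t" "column_strict s (2 # t)" by simp_all
    then have x2: "x = 2" using m by simp
    have "row_insert 2 t = (2 # t, c)" using ta tb b2 Some x2 * e by (simp add: lower_insert_def)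
    \<comment> \<open>A bump would preserve the length of \<open>t\<close>, so the 2 is
      appended.\<close>
    then have "2 # t = t @ [2]" using row_insert_NoneD[of 2 t] row_insert_SomeD[of 2 t] by (cases c) auto
    then have tr: "t = replicate (length t) 2" using replicate_eq_if_snoc_eq_Cons[of t 2] by simp
    then have t2: "2 # t = replicate (Suc (length t)) 2" by simp
    \<comment> \<open>The index \<open>length t\<close> is included: \<open>2 # t\<close> reaches
      one column further than \<open>t\<close>, and that column is the singleton 1-column.\<close>
    have sl: "s ! i = 1" if "i \<le> length t" for i
    proof -
      have "i < length s" using column_strict_length[OF e(3)] that by simp
      moreover have "s ! i < (2 # t) ! i" using column_strict_nth[OF e(3), of i] that by simp
      moreover have "(2 # t) ! i = 2" unfolding t2 using that by (simp del: replicate_Suc)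
      moreover have "1 \<le> s ! i" using s1 \<open>i < length s\<close> by simp
      ultimately show ?thesis by linarith
    qed
    have "set s \<subseteq> insert x (set sa)" using arg_cong[OF x(1), of set_mset] by auto
    then have "\<forall>u\<in>set s. 1 \<le> u \<and> u \<le> 2" using n(2) s1 x2 by auto
    then have s12: "\<forall>u\<in>set s. u = 1 \<or> u = 2" by force
    \<comment> \<open>The 2 bumped by the 1 lies beyond the ones just found, so it is a singleton
      2-column.\<close>
    obtain i where i: "i < length s" "s ! i = 2" using x x2 by (auto simp: in_set_conv_nth)
    moreover have "length t \<le> i" using i sl[of i] by (cases "length t \<le> i") auto
    moreover have "\<forall>i<length t. t ! i = 2" using tr by (metis nth_replicate)
    moreover have "length t < length s" using column_strict_length[OF e(3)] by simp
    moreover from this have "\<exists>k<length s. length t \<le> k \<and> s ! k = 1" using sl by auto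
    ultimately show ?thesis using sl s12 i unfolding balanced12_def by (meson less_imp_le nth_mem)
  qed
  moreover have "sb = 1 # s' \<and> tb = t' \<and> c = None \<and> c2 = None" if bal: "balanced12 s t"
  proof (cases "length t < length s")
    case False
    then have len: "length s = length t" using column_strict_length[OF cs] by simp
    have s: "s = replicate (length s) 1" and t: "t = replicate (length s) 2"
      using bal len by (auto simp: balanced12_def list_eq_iff_nth_eq)
    from inv_cases show ?thesis
    proof cases
      case eq
      then show ?thesis using len column_strict_length by fastforce
    next
      case ext
      have "\<forall>u\<in>set s. u = 1" using s by (metis in_set_replicate)
      then have "R1 = []" using ext by (cases R1) auto
      then have R: "R1 = []" "R2 = []" using ext column_strict_length[of R1 R2] by auto
      then have L2: "L2 @ [e] = replicate (length s) 2 @ [2]"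
        using t ext by (simp add: replicate_append_same)
      have "\<forall>u\<in>set s. u \<le> 1" using s by (metis in_set_replicate order_refl)
      then have "\<forall>u\<in>set (s @ [1]). u \<le> 2" "sa = s @ [1]" "b = None"
        using row_insert_le[of s 1] sa by fastforce+
      then have sa': "sa = s @ [1]" "b = None" "\<forall>u\<in>set sa. u \<le> 2" by simp_all
      then have "sb = s @ [1, 2]" "b2 = None" using row_insert_le[of sa 2] sb by auto
      moreover have "s @ [1] = 1 # s" using s by (metis replicate_append_same)
      ultimately show ?thesis using sa' ta tb L2 R ext t by (auto simp: lower_insert_def)
    qed
  next
    case True
    have t: "t = replicate (length t) 2"
      using bal by (auto simp: balanced12_def list_eq_iff_nth_eq)
    obtain j where j: "j < length s" "length t \<le> j" "s ! j = 1" using bal True by (auto simp: balanced12_def)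
    have s12: "\<forall>u\<in>set s. u = 1 \<or> u = 2"
      using bal by (auto simp: balanced12_def in_set_conv_nth) (metis not_le)
    have two: "2 \<in> set s" using bal True by (auto simp: balanced12_def in_set_conv_nth)
    have eq: "s' = s \<and> t' = 2 # t"
      using inv_cases
    proof cases
      case ext
      \<comment> \<open>The first entry of \<open>R1\<close> would be at least 2, yet it lies weakly
        left of the singleton 1-column at \<open>j\<close> in the sorted row
        \<open>s\<close>.\<close>
      have "length L1 \<le> length t" using ext by (metis length_append_singleton length_Cons nat.inject length_append le_add1)
      then have "s ! length L1 \<le> s ! j" "length L1 < length s"
        using sorted_nth_mono[OF sorted_s, of "length L1" j] j by simp_all
      then have "R1 \<noteq> []" "hd R1 \<le> 1" using ext j by (auto simp: hd_conv_nth nth_append)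
      then show ?thesis using ext by (cases R1) auto
    qed simp
    obtain x where x: "b = Some x"
      using row_insert_NoneD[of 1 s sa] sa two by (cases b) auto
    have m: "1 < x" "x \<in> set s" "add_mset x (mset sa) = add_mset 1 (mset s)"
      using row_insert_SomeD[of 1 s sa x] sa x by auto
    then have x2: "x = 2" using s12 by auto
    have "\<forall>u\<in>set sa. u \<le> 2" using row_insert_set[OF sa] s12 by fastforce
    then have sb': "sb = sa @ [2]" "b2 = None" using row_insert_le[of sa 2] sb by auto
    \<comment> \<open>A sorted row is determined by its multiset, which avoids locating the 2 that
      is bumped.\<close>
    have "sorted sa" using row_insert_sorted[OF sorted_s, of 1] sa by simp
    then have "sorted sb" using sb' \<open>\<forall>u\<in>set sa. u \<le> 2\<close> by (simp add: sorted_append)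
    moreover have "sorted (1 # s)" using sorted_s s1 by simp
    moreover have "mset sb = mset (1 # s)" using sb' m x2 by simp
    ultimately have "sb = 1 # s" by (rule sorted_mset_eqI)
    moreover have "\<forall>u\<in>set t. u \<le> 2" using t by (metis in_set_replicate order_refl)
    then have "row_insert 2 t = (t @ [2], None)" by (rule row_insert_le)
    moreover have "t @ [2] = 2 # t" using t by (metis replicate_append_same)
    ultimately show ?thesis using eq x x2 sb' ta tb by (simp add: lower_insert_def)
  qed
  ultimately show ?thesis using rest unfolding top snd_row st[symmetric] by blast
qed

section \<open>Columns of a tableau\<close>

text \<open>The form in which \<open>nth_transpose\<close> gives the entries of a transpose.\<close>

definition column :: "'a tableau \<Rightarrow> nat \<Rightarrow> 'a list" where
  "column T i = map (\<lambda>r. r ! i) (filter (\<lambda>r. i < length r) T)"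

lemma set_columns:
  assumes "semistandard T"
  shows "set (columns T) = column T ` {..<length (top_row T)}"
proof -
  \<comment> \<open>The fold is the length of the transpose as given by
    \<open>length_transpose\<close>; column strictness makes the first row the longest.\<close>
  have len: "foldr (\<lambda>xs. max (length xs)) T 0 = length (top_row T)"
    using assms by (induction T) (auto dest!: column_strict_length)
  have "columns T = map (column T) [0..<length (top_row T)]"
    unfolding columns_def
    by (rule nth_equalityI) (simp_all add: length_transpose len nth_transpose column_def)
  then show ?thesis by (simp add: lessThan_atLeast0)
qed

lemma column_Cons:
  assumes "semistandard (r # rs)" "i < length r"
  shows "column (r # rs) i = r ! i # column rs i"
  using assms by (simp add: column_def)

lemma column_empty:
  assumes "semistandard T" "length (top_row T) \<le> i"
  shows "column T i = []"
  using assms by (induction T) (auto simp: column_def dest!: column_strict_length)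

lemma set_column_lower_bound:
  fixes T :: "nat tableau"
  assumes "semistandard T" "\<forall>a\<in>set (top_row T). k \<le> a"
  shows "\<forall>a\<in>set (column T i). k \<le> a"
  using assms
proof (induction T)
  case (Cons r rs)
  then have "\<forall>a\<in>set (top_row rs). Suc k \<le> a" using column_strict_lower_bound[of r "top_row rs" k] by simp
  moreover from this have "\<forall>a\<in>set (top_row rs). k \<le> a" by (auto dest: Suc_leD)
  ultimately show ?case using Cons by (auto simp: column_def)
qed (simp add: column_def)

text \<open>Entries from the third row on are at least 3 and those of the second row at least 2.
  Hence a column contains both 1 and 2 exactly when they are its first two entries.\<close>

lemma columns_balanced12_iff:
  fixes T :: "nat tableau"
  assumes T: "semistandard T" and s1: "\<forall>a\<in>set (top_row T). 1 \<le> a"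
  shows "((\<forall>c\<in>set (columns T).
        length c = 1 \<longrightarrow> singleton_column 1 c \<or> singleton_column 2 c) \<and>
     ((\<exists>c\<in>set (columns T). length c = 1) \<longrightarrow>
        (\<exists>c\<in>set (columns T). singleton_column 1 c) \<and>
        (\<exists>c\<in>set (columns T). singleton_column 2 c))) \<and>
    (\<forall>c\<in>set (columns T).
        2 \<le> length c \<longrightarrow> 1 \<in> set c \<and> 2 \<in> set c) \<longleftrightarrow>
    balanced12 (top_row T) (top_row (tl T))"
proof -
  define s t R where st: "s = top_row T" "t = top_row (tl T)" "R = tl (tl T)"
  have cs: "column_strict s t" and ss: "semistandard (tl T)" "semistandard R"
    using T unfolding st by (cases T; cases "tl T"; simp)+
  have cs2: "column_strict t (top_row R)" using ss(1) unfolding st by (cases "tl T") auto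
  have s1: "\<forall>a\<in>set s. 1 \<le> a" using s1 unfolding st .
  have t2: "\<forall>a\<in>set t. 2 \<le> a" using column_strict_lower_bound[OF cs s1] by (simp add: numeral_2_eq_2)
  have R3: "\<forall>a\<in>set (column R i). 3 \<le> a" for i
    using column_strict_lower_bound[OF cs2 t2] by (intro set_column_lower_bound ss) simp
  have short: "column T i = [s ! i]" if "i < length s" "length t \<le> i" for i
    using that T column_empty[OF ss(1), of i] unfolding st by (cases T) (auto simp: column_Cons)
  have long: "column T i = s ! i # t ! i # column R i" if "i < length t" for i
  proof -
    have "i < length s" using that column_strict_length[OF cs] by simp
    then show ?thesis using that T unfolding st
      by (cases T; cases "tl T") (auto simp: column_Cons)
  qed
  have len1: "length (column T i) = 1 \<longleftrightarrow> length t \<le> i" if "i < length s" for i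
    using short[OF that] long[of i] by (cases "length t \<le> i") auto
  have len2: "2 \<le> length (column T i) \<longleftrightarrow> i < length t" if "i < length s" for i
    using short[OF that] long[of i] by (cases "length t \<le> i") auto
  have sing: "singleton_column a (column T i) \<longleftrightarrow> length t \<le> i \<and> s ! i = a" if "i < length s" for i a
    using short[OF that] long[of i] by (cases "length t \<le> i") (auto simp: singleton_column_def)
  have both: "1 \<in> set (column T i) \<and> 2 \<in> set (column T i) \<longleftrightarrow> s ! i = 1 \<and> t ! i = 2"
    if "i < length t" for i
  proof -
    have "1 \<notin> set (column R i)" "2 \<notin> set (column R i)" "t ! i \<noteq> 1"
      using R3[of i] t2 nth_mem[OF that] by force+
    then show ?thesis unfolding long[OF that] by auto
  qed
  have lt: "i < length s" if "i < length t" for i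
    using that column_strict_length[OF cs] by simp
  let ?C = "set (columns T)"
  have C: "?C = column T ` {..<length s}"
    using set_columns[OF T] st by simp
  have "(\<forall>c\<in>?C. length c = 1 \<longrightarrow> singleton_column 1 c \<or> singleton_column 2 c) \<longleftrightarrow>
      (\<forall>i<length s. length t \<le> i \<longrightarrow> s ! i = 1 \<or> s ! i = 2)"
    unfolding C using len1 sing by (auto simp del: One_nat_def)
  moreover have "(\<exists>c\<in>?C. length c = 1) \<longleftrightarrow> length t < length s"
    unfolding C using len1 by (auto simp del: One_nat_def)
  moreover have "(\<exists>c\<in>?C. singleton_column a c) \<longleftrightarrow> (\<exists>i<length s. length t \<le> i \<and> s ! i = a)" for a
    unfolding C using sing by (auto simp del: One_nat_def)
  moreover have "(\<forall>c\<in>?C. 2 \<le> length c \<longrightarrow> 1 \<in> set c \<and> 2 \<in> set c) \<longleftrightarrow>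
      (\<forall>i<length t. s ! i = 1 \<and> t ! i = 2)"
    unfolding C using len2 both lt by (auto simp del: One_nat_def)
  ultimately show ?thesis
    unfolding balanced12_def st(1,2)[symmetric] by blast
qed

section \<open>Knuth equivalence of the two words\<close>

lemma insertion_tableau_append_12:
  "insertion_tableau (w @ [1, 2]) = tableau_insert 2 (tableau_insert 1 (insertion_tableau w))"
  by (simp add: insertion_tableau_def)

lemma top_row_insertion_tableau_subset: "set (top_row (insertion_tableau w)) \<subseteq> set w"
proof -
  have "set (top_row (fold tableau_insert w T)) \<subseteq> set w \<union> set (top_row T)" for T
  proof (induction w arbitrary: T)
    case (Cons x w)
    have "set (top_row (tableau_insert x T)) \<subseteq> insert x (set (top_row T))"
      using row_insert_set[of x "top_row T"] by (metis top_row_tableau_insert prod.collapse)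
    then show ?case using Cons[of "tableau_insert x T"] by auto
  qed simp
  from this[of "[]"] show ?thesis by (simp add: insertion_tableau_def)
qed

theorem theorem3p4:
  fixes w :: "nat list"
  assumes "\<forall>a\<in>set w. 1 \<le> a"
  shows "knuth_equiv ([1, 2] @ w) (w @ [1, 2]) \<longleftrightarrow>
    ((\<forall>c\<in>set (columns (insertion_tableau w)).
        length c = 1 \<longrightarrow> singleton_column 1 c \<or> singleton_column 2 c) \<and>
     ((\<exists>c\<in>set (columns (insertion_tableau w)). length c = 1) \<longrightarrow>
        (\<exists>c\<in>set (columns (insertion_tableau w)). singleton_column 1 c) \<and>
        (\<exists>c\<in>set (columns (insertion_tableau w)). singleton_column 2 c))) \<and>
    (\<forall>c\<in>set (columns (insertion_tableau w)).
        2 \<le> length c \<longrightarrow> 1 \<in> set c \<and> 2 \<in> set c)"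
proof -
  let ?T = "insertion_tableau w"
  have pos: "\<forall>a\<in>set (top_row ?T). 1 \<le> a"
    using assms top_row_insertion_tableau_subset[of w] by auto
  obtain s' t' where st: "left_insert2 (top_row ?T) (top_row (tl ?T)) s' t'"
    "top_row (insertion_tableau ([1, 2] @ w)) = 1 # s'"
    "top_row (tl (insertion_tableau ([1, 2] @ w))) = t'"
    "tl (tl (insertion_tableau ([1, 2] @ w))) = tl (tl ?T)"
    using insertion_tableau_12_append[OF assms] .
  let ?U = "insertion_tableau (w @ [1, 2])"
  have "knuth_equiv ([1, 2] @ w) (w @ [1, 2]) \<longleftrightarrow>
      top_row ?U = 1 # s' \<and> top_row (tl ?U) = t' \<and> tl (tl ?U) = tl (tl ?T)"
    using semistandard_eqI[OF semistandard_insertion_tableau[of "[1, 2] @ w"]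
        semistandard_insertion_tableau[of "w @ [1, 2]"]] st(2-4)
    by (auto simp only: knuth_equiv_def)
  also have "\<dots> \<longleftrightarrow> balanced12 (top_row ?T) (top_row (tl ?T))"
    by (rule balanced12_iff[OF semistandard_insertion_tableau pos st(1) insertion_tableau_append_12])
  finally show ?thesis
    unfolding columns_balanced12_iff[OF semistandard_insertion_tableau pos] .
qed

end
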